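(* Every hereditary graph class of almost bounded merge-width has almost bounded flip-width.
   Context: Graphs are finite, simple and undirected: $G=(V,E(G))$ with $E(G)\subseteq\binom V2$. A graph class is hereditary if it is closed under taking induced subgraphs. Merge-width. A construction sequence on $V$ is a sequence of steps maintaining a partition $\mathcal P$ of $V$ and a partition of $\binom V2$ into edges $E$, non-edges $N$, and unresolved pairs $U$. Initially $\mathcal P$ is the partition into singletons and $U=\binom V2$. In each step one of three operations is performed: merge two parts $A,B\in\mathcal P$, replacing them by $A\cup B$; resolve positively a pair of parts $A,B\in\mathcal P$ (possibly $A=B$), moving all $\{a,b\}\in U$ with $a\in A,b\in B$ from $U$ to $E$; or resolve negatively such a pair of parts, moving these pairs from $U$ to $N$. In the end $\mathcal P$ has one part and $U=\emptyset$; it is then a construction sequence of the graph $(V,E)$. Its radius-$r$ width is the least $k$ such that at every step, for every $v\in V$, at most $k$ parts of the current $\mathcal P$ contain a vertex reachable from $v$ by a path of length at most $r$ in the graph $(V,E\cup N)$ for the current $E,N$. The radius-$r$ merge-width $\mathrm{mw}_r(G)$ is the least radius-$r$ width of a construction sequence of $G$. Flip-width. For $A,B\subseteq V(G)$ let $AB=\{\{a,b\}:a\in A,b\in B,a\neq b\}$. For a partition $\mathcal P$ of $V(G)$, a $\mathcal P$-flip of $G$ is a graph $G'$ on $V(G)$ such that for all $A,B\in\mathcal P$ (possibly $A=B$), either $E(G')\cap AB=E(G)\cap AB$ or $E(G')\cap AB=AB\setminus E(G)$. A $k$-flip is a $\mathcal P$-flip for some $\mathcal P$ with $|\mathcal P|\le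 k$. The flip-width game of radius $r$ and width $k$ on $G$ is played by flipper and runner. Set $G_0=G$. Initially runner picks $v_0\in V(G)$. In round $t=1,2,\dots$, flipper announces a $k$-flip $G_t$ of $G$; then runner picks $v_t$ at distance at most $r$ from $v_{t-1}$ in the previous graph $G_{t-1}$. Flipper wins if $v_t$ is isolated in $G_t$. The radius-$r$ flip-width $\mathrm{fw}_r(G)$ is the least $k$ such that flipper has a winning strategy in this game. A graph class $\mathcal C$ has almost bounded merge-width (resp. almost bounded flip-width) if for every $r\in\mathbb N$ and $\varepsilon>0$ we have $\mathrm{mw}_r(G)\le O_{\mathcal C,r,\varepsilon}(|V(G)|^{\varepsilon})$ (resp. $\mathrm{fw}_r(G)\le O_{\mathcal C,r,\varepsilon}(|V(G)|^{\varepsilon})$) for all $G\in\mathcal C$, where the hidden constants depend only on $\mathcal C,r,\varepsilon$. *)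

theory Defs
  imports Complex_Main "HOL-Library.Disjoint_Sets"
begin

type_synonym 'a graph = "'a set \<times> 'a set set"

abbreviation verts :: "'a graph \<Rightarrow> 'a set" where
  "verts G \<equiv> fst G"

abbreviation edges :: "'a graph \<Rightarrow> 'a set set" where
  "edges G \<equiv> snd G"

definition all_pairs :: "'a set \<Rightarrow> 'a set set" where
  "all_pairs V = {e. e \<subseteq> V \<and> card e = 2}"

definition is_graph :: "'a graph \<Rightarrow> bool" where
  "is_graph G \<longleftrightarrow> finite (verts G) \<and> edges G \<subseteq> all_pairs (verts G)"

definition induced_subgraph :: "'a graph \<Rightarrow> 'a set \<Rightarrow> 'a graph" where
  "induced_subgraph G W = (W, {e \<in> edges G. e \<subseteq> W})"

text \<open>A graph class is a set of finite graphs with vertices taken from an arbitrary type.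
  Closure under isomorphism is not required.\<close>

definition graph_class :: "'a graph set \<Rightarrow> bool" where
  "graph_class C \<longleftrightarrow> (\<forall>G\<in>C. is_graph G)"

definition hereditary :: "'a graph set \<Rightarrow> bool" where
  "hereditary C \<longleftrightarrow> (\<forall>G\<in>C. \<forall>W. W \<subseteq> verts G \<longrightarrow> induced_subgraph G W \<in> C)"

definition pairs_between :: "'a set \<Rightarrow> 'a set \<Rightarrow> 'a set set" where
  "pairs_between A B = {{a, b} | a b. a \<in> A \<and> b \<in> B \<and> a \<noteq> b}"

definition is_path :: "'a graph \<Rightarrow> 'a list \<Rightarrow> bool" where
  "is_path G p \<longleftrightarrow> p \<noteq> [] \<and> distinct p \<and> set p \<subseteq> verts G \<and>
     successively (\<lambda>u v. {u, v} \<in> edges G) p"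

text \<open>A path on \<open>m\<close> vertices has length \<open>m - 1\<close>.\<close>

definition within_dist :: "'a graph \<Rightarrow> nat \<Rightarrow> 'a \<Rightarrow> 'a \<Rightarrow> bool" where
  "within_dist G r u v \<longleftrightarrow>
     (\<exists>p. is_path G p \<and> hd p = u \<and> last p = v \<and> length p - 1 \<le> r)"


subsection \<open>Merge-width\<close>

text \<open>A state \<open>(P, E, N, U)\<close> consists of the current partition of the vertex set and the
  current sets of edges, non-edges and unresolved pairs.\<close>

type_synonym 'a state = "'a set set \<times> 'a set set \<times> 'a set set \<times> 'a set set"

definition initial_state :: "'a set \<Rightarrow> 'a state" where
  "initial_state V = ((\<lambda>v. {v}) ` V, {}, {}, all_pairs V)"

inductive construction_step :: "'a state \<Rightarrow> 'a state \<Rightarrow> bool" where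
  merge: "A \<in> P \<Longrightarrow> B \<in> P \<Longrightarrow> A \<noteq> B \<Longrightarrow>
    construction_step (P, E, N, U) (insert (A \<union> B) (P - {A, B}), E, N, U)"
| resolve_pos: "A \<in> P \<Longrightarrow> B \<in> P \<Longrightarrow>
    construction_step (P, E, N, U)
      (P, E \<union> (U \<inter> pairs_between A B), N, U - pairs_between A B)"
| resolve_neg: "A \<in> P \<Longrightarrow> B \<in> P \<Longrightarrow>
    construction_step (P, E, N, U)
      (P, E, N \<union> (U \<inter> pairs_between A B), U - pairs_between A B)"

text \<open>The sequence is given as the list of the states it passes through, the initial and the
  final state included.\<close>

definition construction_sequence :: "'a graph \<Rightarrow> 'a state list \<Rightarrow> bool" where
  "construction_sequence G ss \<longleftrightarrow>
     ss \<noteq> [] \<and> hd ss = initial_state (verts G) \<and> successively construction_step ss \<and>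
     (\<exists>N. last ss = ({verts G}, edges G, N, {}))"

definition radius_width_le :: "nat \<Rightarrow> 'a graph \<Rightarrow> 'a state list \<Rightarrow> nat \<Rightarrow> bool" where
  "radius_width_le r G ss k \<longleftrightarrow>
     (\<forall>(P, E, N, U) \<in> set ss. \<forall>v \<in> verts G.
        card {A \<in> P. \<exists>w\<in>A. within_dist (verts G, E \<union> N) r v w} \<le> k)"

definition radius_width :: "nat \<Rightarrow> 'a graph \<Rightarrow> 'a state list \<Rightarrow> nat" where
  "radius_width r G ss = (LEAST k. radius_width_le r G ss k)"

text \<open>Every graph with at least one vertex has a construction sequence (resolve all pairs of
  singletons, then merge), so the minimum exists. The graph without vertices has none, because
  the final partition must consist of one part.\<close>

definition merge_width :: "nat \<Rightarrow> 'a graph \<Rightarrow> nat" where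
  "merge_width r G = (LEAST k. \<exists>ss. construction_sequence G ss \<and> k = radius_width r G ss)"


subsection \<open>Flip-width\<close>

definition partition_flip :: "'a set set \<Rightarrow> 'a graph \<Rightarrow> 'a graph \<Rightarrow> bool" where
  "partition_flip P G G' \<longleftrightarrow> is_graph G' \<and> verts G' = verts G \<and>
     (\<forall>A\<in>P. \<forall>B\<in>P.
        edges G' \<inter> pairs_between A B = edges G \<inter> pairs_between A B \<or>
        edges G' \<inter> pairs_between A B = pairs_between A B - edges G)"

definition k_flip :: "nat \<Rightarrow> 'a graph \<Rightarrow> 'a graph \<Rightarrow> bool" where
  "k_flip k G G' \<longleftrightarrow> (\<exists>P. partition_on (verts G) P \<and> card P \<le> k \<and> partition_flip P G G')"

definition isolated :: "'a graph \<Rightarrow> 'a \<Rightarrow> bool" where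
  "isolated G v \<longleftrightarrow> (\<forall>e \<in> edges G. v \<notin> e)"

text \<open>A flipper strategy \<open>\<sigma>\<close> maps the list of runner's previous positions
  \<open>v\<^sub>0, \<dots>, v\<^sub>t\<^sub>-\<^sub>1\<close> to the graph announced in round \<open>t \<ge> 1\<close>.\<close>

definition played_graph :: "'a graph \<Rightarrow> ('a list \<Rightarrow> 'a graph) \<Rightarrow> (nat \<Rightarrow> 'a) \<Rightarrow> nat \<Rightarrow> 'a graph" where
  "played_graph G \<sigma> v t = (if t = 0 then G else \<sigma> (map v [0..<t]))"

definition legal_strategy :: "nat \<Rightarrow> 'a graph \<Rightarrow> ('a list \<Rightarrow> 'a graph) \<Rightarrow> bool" where
  "legal_strategy k G \<sigma> \<longleftrightarrow> (\<forall>h. h \<noteq> [] \<and> set h \<subseteq> verts G \<longrightarrow> k_flip k G (\<sigma> h))"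

definition runner_play :: "nat \<Rightarrow> 'a graph \<Rightarrow> ('a list \<Rightarrow> 'a graph) \<Rightarrow> (nat \<Rightarrow> 'a) \<Rightarrow> bool" where
  "runner_play r G \<sigma> v \<longleftrightarrow> v 0 \<in> verts G \<and>
     (\<forall>t\<ge>1. v t \<in> verts G \<and> within_dist (played_graph G \<sigma> v (t - 1)) r (v (t - 1)) (v t))"

text \<open>Plays are continued forever, so flipper wins a play iff the winning condition holds in
  some round; what happens in later rounds is irrelevant.\<close>

definition flipper_wins :: "nat \<Rightarrow> nat \<Rightarrow> 'a graph \<Rightarrow> bool" where
  "flipper_wins r k G \<longleftrightarrow> (\<exists>\<sigma>. legal_strategy k G \<sigma> \<and>
     (\<forall>v. runner_play r G \<sigma> v \<longrightarrow> (\<exists>t\<ge>1. isolated (played_graph G \<sigma> v t) (v t))))"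

text \<open>The minimum exists: with width \<open>|V|\<close> flipper can announce the edgeless graph.\<close>

definition flip_width :: "nat \<Rightarrow> 'a graph \<Rightarrow> nat" where
  "flip_width r G = (LEAST k. flipper_wins r k G)"


subsection \<open>Almost bounded parameters\<close>

text \<open>The graph without vertices is left out: it belongs to every nonempty hereditary class, but
  its merge-width is undefined.\<close>

definition almost_bounded :: "(nat \<Rightarrow> 'a graph \<Rightarrow> nat) \<Rightarrow> 'a graph set \<Rightarrow> bool" where
  "almost_bounded width C \<longleftrightarrow>
     (\<forall>r::nat. \<forall>\<epsilon>::real. \<epsilon> > 0 \<longrightarrow>
        (\<exists>c::real. \<forall>G\<in>C. verts G \<noteq> {} \<longrightarrow>
           real (width r G) \<le> c * real (card (verts G)) powr \<epsilon>))"

definition almost_bounded_merge_width :: "'a graph set \<Rightarrow> bool" where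
  "almost_bounded_merge_width C \<longleftrightarrow> almost_bounded merge_width C"

definition almost_bounded_flip_width :: "'a graph set \<Rightarrow> bool" where
  "almost_bounded_flip_width C \<longleftrightarrow> almost_bounded flip_width C"

end

theory Submission
  imports Defs
begin

text \<open>
  Let \<open>k\<close> be the radius-\<open>(2r+1)\<close> merge-width of \<open>G\<close>, witnessed by some construction sequence.
  Flipper plays this sequence backwards. At any state with partition \<open>P\<close> and set \<open>R\<close> of
  resolved pairs, the unresolved pairs between two parts will all be resolved in the same way, so
  they are all edges of \<open>G\<close> or all non-edges (lemma \<open>agrees_with_step\<close>). Flipping each pair of parts
  suitably would therefore leave only edges in \<open>R\<close>, but \<open>P\<close> has too many parts. Flipper only
  controls a ball around runner: the at most \<open>k\<close> parts meeting the radius-\<open>(2r+1)\<close> ball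
  are kept, and all other vertices are grouped by their adjacency to at most \<open>k\<close> representatives of
  the parts near runner. With \<open>N\<close> such groups this gives a \<open>(k + N)\<close>-flip in which runner moves along
  resolved pairs only (lemma \<open>confining_flip\<close>). One state earlier per round, runner ends up in the
  initial state, where nothing is resolved and hence the current vertex is isolated (lemma
  \<open>flipper_wins\<close>).

  It remains to see that \<open>N\<close> is polynomial in \<open>k\<close>; a polynomial in \<open>k \<le> O(n\<^sup>\<delta>)\<close> is
  \<open>O(n\<^sup>\<epsilon>)\<close> for \<open>\<delta>\<close> small enough. By the Sauer--Shelah lemma it suffices that no set of
  size \<open>d\<close> is shattered by neighbourhoods, for a constant \<open>d\<close> depending on the class, and here
  heredity enters. From a shattered set of size \<open>q\<^sup>2\<close> one can choose \<open>q\<^sup>2\<close> vertices so that the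
  bipartite adjacency is any prescribed relation. Take the relation in which two cells of a
  \<open>q \<times> q\<close> board are related when they share a row or a column. Any two vertices on the same side
  then differ on at least \<open>q - 2\<close> vertices of the other side. When a construction
  sequence first merges two vertices of the same side, each vertex on which they differ has been
  resolved with one of the two, and no two vertices of the other side share a part; so the radius-1 width
  is at least \<open>(q - 2) / 2\<close> (lemma \<open>width_ge_half_difference\<close>). This grows like the square root of
  the number \<open>2q\<^sup>2\<close> of vertices of that induced subgraph, which contradicts almost bounded
  merge-width at exponent \<open>1/4\<close> (lemma \<open>no_large_shattered_set\<close>).
\<close>

section \<open>Balls\<close>

lemma within_dist_refl: "u \<in> verts G \<Longrightarrow> within_dist G r u u"
  unfolding within_dist_def is_path_def by (rule exI[of _ "[u]"]) auto

lemma within_dist_mono_radius: "within_dist G r u v \<Longrightarrow> r \<le> s \<Longrightarrow> within_dist G s u v"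
  unfolding within_dist_def by fastforce

lemma within_dist_extend:
  assumes "within_dist G r u v" and "{v, w} \<in> edges G" and "w \<in> verts G"
  shows "within_dist G (Suc r) u w"
proof -
  obtain p where p: "is_path G p" "hd p = u" "last p = v" "length p - 1 \<le> r"
    using assms(1) unfolding within_dist_def by blast
  show ?thesis
  proof (cases "w \<in> set p")
    case True
    then obtain xs ys where xy: "p = xs @ w # ys"
      by (meson split_list)
    have "is_path G (xs @ [w])"
      using p(1) unfolding is_path_def xy by (auto simp: successively_append_iff)
    moreover have "hd (xs @ [w]) = u"
      using p(2) unfolding xy by (cases xs) auto
    moreover have "length (xs @ [w]) - 1 \<le> Suc r"
      using p(4) unfolding xy by auto
    ultimately show ?thesis
      unfolding within_dist_def by (metis last_snoc)
  next
    case False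
    have "is_path G (p @ [w])"
      using p False assms(2,3) unfolding is_path_def by (auto simp: successively_append_iff)
    moreover have "hd (p @ [w]) = u"
      using p unfolding is_path_def by auto
    moreover have "length (p @ [w]) - 1 \<le> Suc r"
      using p by auto
    ultimately show ?thesis
      unfolding within_dist_def by (metis last_snoc)
  qed
qed

lemma within_dist_verts:
  "within_dist G r u v \<Longrightarrow> u \<in> verts G \<and> v \<in> verts G"
  unfolding within_dist_def is_path_def by auto

text \<open>While the path has not left the ball of radius \<open>n\<close>, its next edge lies in \<open>R\<close>; since \<open>R \<subseteq> R'\<close>,
  this edge extends the distance from \<open>v\<close> by one only. So the path stays in the ball and
  uses only pairs of \<open>R\<close>.\<close>

lemma path_confined:
  assumes "successively (\<lambda>a b. {a, b} \<in> H) p" and "p \<noteq> []" and "set p \<subseteq> V"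
    and "within_dist (V, R') m v (hd p)" and "m + (length p - 1) \<le> n" and "R \<subseteq> R'"
    and "\<And>x y. within_dist (V, R') n v x \<Longrightarrow> {x, y} \<in> H \<Longrightarrow> {x, y} \<in> R"
  shows "successively (\<lambda>a b. {a, b} \<in> R) p"
  using assms(1-5)
proof (induction p arbitrary: m)
  case Nil
  then show ?case by simp
next
  case (Cons x p)
  show ?case
  proof (cases p)
    case Nil
    then show ?thesis by simp
  next
    case (Cons y p')
    have xy: "{x, y} \<in> R"
      using assms(7)[of x y] Cons.prems Cons within_dist_mono_radius[of "(V, R')" m v x n] by auto
    then have "within_dist (V, R') (Suc m) v y"
      using within_dist_extend[of "(V, R')" m v x y] Cons.prems Cons assms(6) by auto
    then have "successively (\<lambda>a b. {a, b} \<in> R) p"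
      using Cons.IH[of "Suc m"] Cons.prems Cons by auto
    then show ?thesis
      using xy Cons by auto
  qed
qed

text \<open>This is how flipper keeps control for one more round: from a vertex \<open>y\<close> that runner reached
  from \<open>v\<close> along \<open>R'\<close>, the next move is along \<open>R\<close>.\<close>

lemma within_dist_confined:
  assumes "within_dist (V, H) r y z" and "within_dist (V, R') r v y" and "R \<subseteq> R'"
    and "\<And>x y. within_dist (V, R') (2 * r) v x \<Longrightarrow> {x, y} \<in> H \<Longrightarrow> {x, y} \<in> R"
  shows "within_dist (V, R) r y z"
proof -
  obtain p where p: "is_path (V, H) p" "hd p = y" "last p = z" "length p - 1 \<le> r"
    using assms(1) unfolding within_dist_def by blast
  have "successively (\<lambda>a b. {a, b} \<in> R) p"
    by (rule path_confined[of H p V R' r v "2 * r"]) (use p assms in \<open>auto simp: is_path_def\<close>)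
  then show ?thesis
    using p unfolding within_dist_def is_path_def by auto
qed

section \<open>Resolution sequences\<close>

text \<open>Here \<open>R\<close> stands for the resolved pairs: the unresolved pairs between two parts are all edges
  or all non-edges.\<close>

definition homogeneous :: "'a graph \<Rightarrow> 'a set set \<Rightarrow> 'a set set \<Rightarrow> bool" where
  "homogeneous G P R \<longleftrightarrow> (\<forall>A\<in>P. \<forall>B\<in>P. \<forall>a\<in>A. \<forall>a'\<in>A. \<forall>b\<in>B. \<forall>b'\<in>B.
     a \<noteq> b \<and> a' \<noteq> b' \<and> {a, b} \<notin> R \<and> {a', b'} \<notin> R \<longrightarrow>
     ({a, b} \<in> edges G \<longleftrightarrow> {a', b'} \<in> edges G))"

definition width_bound :: "'a set \<Rightarrow> nat \<Rightarrow> nat \<Rightarrow> 'a set set \<Rightarrow> 'a set set \<Rightarrow> bool" where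
  "width_bound V r k P R \<longleftrightarrow>
     (\<forall>v\<in>V. card {A \<in> P. \<exists>w\<in>A. within_dist (V, R) r v w} \<le> k)"

text \<open>What the proof uses of a construction sequence: the partition \<open>P i\<close> and the resolved pairs \<open>R i\<close>
  of its \<open>i\<close>-th state. The assumption \<open>step\<close> holds because a merge changes only the partition and a
  resolution changes only the resolved pairs.\<close>

locale resolution_sequence =
  fixes G :: "'a graph" and P :: "nat \<Rightarrow> 'a set set" and R :: "nat \<Rightarrow> 'a set set" and M :: nat
  assumes graph: "is_graph G"
    and part: "i \<le> M \<Longrightarrow> partition_on (verts G) (P i)"
    and P_0: "P 0 = (\<lambda>v. {v}) ` verts G"
    and R_0: "R 0 = {}"
    and P_M: "P M = {verts G}"
    and R_M: "R M = all_pairs (verts G)"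
    and homog: "i \<le> M \<Longrightarrow> homogeneous G (P i) (R i)"
    and R_mono: "i < M \<Longrightarrow> R i \<subseteq> R (Suc i)"
    and step: "i < M \<Longrightarrow> P i = P (Suc i) \<or> R i = R (Suc i)"

definition valid_state :: "'a set \<Rightarrow> 'a state \<Rightarrow> bool" where
  "valid_state V = (\<lambda>(P, E, N, U). partition_on V P \<and> 
     E \<union> N \<union> U = all_pairs V \<and> (E \<union> N) \<inter> U = {} \<and> E \<inter> N = {})"

lemma partition_on_merge:
  assumes "partition_on V P" and "A \<in> P" and "B \<in> P"
  shows "partition_on V (insert (A \<union> B) (P - {A, B}))"
proof (rule partition_onI)
  show "{} \<notin> insert (A \<union> B) (P - {A, B})"
    using assms(2) partition_onD3[OF assms(1)] by auto
  show "\<Union> (insert (A \<union> B) (P - {A, B})) = V"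
    using assms partition_onD1[OF assms(1)] by auto
  have d: "X \<inter> Y = {}" if "X \<in> P" "Y \<in> P" "X \<noteq> Y" for X Y
    using partition_onD2[OF assms(1)] that unfolding disjoint_def by auto
  have AB: "(A \<union> B) \<inter> X = {}" if "X \<in> P - {A, B}" for X
    using that d[of A X] d[of B X] assms(2,3) by blast
  show "disjnt p p'" if "p \<in> insert (A \<union> B) (P - {A, B})" "p' \<in> insert (A \<union> B) (P - {A, B})"
    "p \<noteq> p'" for p p'
  proof (cases "p = A \<union> B \<or> p' = A \<union> B")
    case True
    then show ?thesis
      using that AB[of p] AB[of p'] unfolding disjnt_def by blast
  next
    case False
    then show ?thesis
      using that d[of p p'] unfolding disjnt_def by blast
  qed
qed

lemma valid_state_initial:
  "valid_state V (initial_state V)"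
  unfolding valid_state_def initial_state_def
  by (auto intro!: partition_onI simp: disjnt_def)

lemma valid_state_step:
  "construction_step s s' \<Longrightarrow> valid_state V s \<Longrightarrow> valid_state V s'"
proof (induction rule: construction_step.induct)
  case (merge A P B E N U)
  then show ?case using partition_on_merge[of V P A B] by (simp add: valid_state_def)
next
  case (resolve_pos A P B U E N)
  then show ?case unfolding valid_state_def prod.case by blast
next
  case (resolve_neg A P B U E N)
  then show ?case unfolding valid_state_def prod.case by blast
qed

text \<open>This property holds in the final state and passes backwards along steps, so it holds in every
  state of a construction sequence of \<open>G\<close>.\<close>

definition agrees_with :: "'a graph \<Rightarrow> 'a state \<Rightarrow> bool" where
  "agrees_with G = (\<lambda>(P, E, N, U). E \<subseteq> edges G \<and> N \<inter> edges G = {} \<and> homogeneous G P (E \<union> N))"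

lemma pairs_between_disjoint_parts:
  assumes "partition_on V P" and "A \<in> P" "B \<in> P" "A' \<in> P" "B' \<in> P"
    and "a \<in> A" "b \<in> B" "{a, b} \<in> pairs_between A' B'"
  shows "(A = A' \<and> B = B') \<or> (A = B' \<and> B = A')"
proof -
  have eq: "X = Y" if "X \<in> P" "Y \<in> P" "x \<in> X" "x \<in> Y" for X Y x
    using partition_onD2[OF assms(1)] that unfolding disjoint_def by auto
  obtain c d where cd: "{a, b} = {c, d}" "c \<in> A'" "d \<in> B'"
    using assms(8) unfolding pairs_between_def by auto
  then have "(a = c \<and> b = d) \<or> (a = d \<and> b = c)"
    by (auto simp: doubleton_eq_iff)
  then show ?thesis
    using eq[of A A' a] eq[of B B' b] eq[of A B' a] eq[of B A' b] assms cd by auto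
qed

text \<open>Backwards over a resolution of \<open>A0\<close> and \<open>B0\<close>: the pairs that become unresolved all lie between
  these two parts and have been resolved alike. Between them no other unresolved pair is left, and
  no other two parts are affected.\<close>

lemma homogeneous_resolve:
  assumes "partition_on V P" and "A0 \<in> P" and "B0 \<in> P"
    and R': "R' \<subseteq> R \<union> pairs_between A0 B0"
    and hom: "homogeneous G P R'"
    and same: "R' - R \<subseteq> edges G \<or> (R' - R) \<inter> edges G = {}"
    and res: "pairs_between A0 B0 \<inter> all_pairs V \<subseteq> R'"
  shows "homogeneous G P R"
  unfolding homogeneous_def
proof (intro ballI impI)
  fix A B a a' b b'
  assume AB: "A \<in> P" "B \<in> P" and ab: "a \<in> A" "a' \<in> A" "b \<in> B" "b' \<in> B"
    and n: "a \<noteq> b \<and> a' \<noteq> b' \<and> {a, b} \<notin> R \<and> {a', b'} \<notin> R"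
  show "({a, b} \<in> edges G) = ({a', b'} \<in> edges G)"
  proof (cases "(A = A0 \<and> B = B0) \<or> (A = B0 \<and> B = A0)")
    case True
    have V: "A \<subseteq> V" "B \<subseteq> V"
      using partition_onD1[OF assms(1)] AB by auto
    have "{a, b} \<in> pairs_between A0 B0" "{a', b'} \<in> pairs_between A0 B0"
      using True ab n unfolding pairs_between_def by blast+
    moreover have "{a, b} \<in> all_pairs V" "{a', b'} \<in> all_pairs V"
      using V ab n unfolding all_pairs_def by auto
    ultimately have "{a, b} \<in> R' - R" "{a', b'} \<in> R' - R"
      using res n by auto
    then show ?thesis
      using same by blast
  next
    case False
    have "{a, b} \<notin> R'" "{a', b'} \<notin> R'"
      using pairs_between_disjoint_parts[OF assms(1) AB assms(2,3)] False ab n R' by blast+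
    then show ?thesis
      using hom AB ab n unfolding homogeneous_def by blast
  qed
qed

lemma agrees_with_step:
  assumes "construction_step s s'" and "valid_state (verts G) s" and "agrees_with G s'"
  shows "agrees_with G s"
  using assms(1)
proof cases
  case (merge A P B E N U)
  have "homogeneous G P (E \<union> N)"
    unfolding homogeneous_def
  proof (intro ballI impI)
    fix X Y a a' b b'
    assume XY: "X \<in> P" "Y \<in> P" and ab: "a \<in> X" "a' \<in> X" "b \<in> Y" "b' \<in> Y"
      and n: "a \<noteq> b \<and> a' \<noteq> b' \<and> {a, b} \<notin> E \<union> N \<and> {a', b'} \<notin> E \<union> N"
    have coarser: "\<exists>Z\<in>insert (A \<union> B) (P - {A, B}). W \<subseteq> Z" if "W \<in> P" for W
      using that by (cases "W = A \<or> W = B") auto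
    obtain X' where "X' \<in> insert (A \<union> B) (P - {A, B})" "X \<subseteq> X'"
      using coarser[OF XY(1)] by blast
    moreover obtain Y' where "Y' \<in> insert (A \<union> B) (P - {A, B})" "Y \<subseteq> Y'"
      using coarser[OF XY(2)] by blast
    moreover have "homogeneous G (insert (A \<union> B) (P - {A, B})) (E \<union> N)"
      using assms(3) merge by (simp add: agrees_with_def)
    ultimately show "({a, b} \<in> edges G) = ({a', b'} \<in> edges G)"
      using ab n unfolding homogeneous_def by (meson subsetD)
  qed
  then show ?thesis
    using assms(3) merge by (simp add: agrees_with_def)
next
  case (resolve_pos A P B E N U)
  let ?R' = "E \<union> (U \<inter> pairs_between A B) \<union> N"
  have v: "partition_on (verts G) P" "E \<union> N \<union> U = all_pairs (verts G)"
    using assms(2) resolve_pos by (simp_all add: valid_state_def)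
  have g: "E \<union> (U \<inter> pairs_between A B) \<subseteq> edges G" "N \<inter> edges G = {}" "homogeneous G P ?R'"
    using assms(3) resolve_pos by (simp_all add: agrees_with_def)
  have "homogeneous G P (E \<union> N)"
    by (rule homogeneous_resolve[OF v(1) resolve_pos(3,4) _ g(3)]) (use v g in blast)+
  then show ?thesis
    using g resolve_pos(1) unfolding agrees_with_def prod.case by blast
next
  case (resolve_neg A P B E N U)
  let ?R' = "E \<union> (N \<union> (U \<inter> pairs_between A B))"
  have v: "partition_on (verts G) P" "E \<union> N \<union> U = all_pairs (verts G)"
    using assms(2) resolve_neg by (simp_all add: valid_state_def)
  have g: "E \<subseteq> edges G" "(N \<union> (U \<inter> pairs_between A B)) \<inter> edges G = {}" "homogeneous G P ?R'"
    using assms(3) resolve_neg by (simp_all add: agrees_with_def)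
  have "homogeneous G P (E \<union> N)"
    by (rule homogeneous_resolve[OF v(1) resolve_neg(3,4) _ g(3)]) (use v g in blast)+
  then show ?thesis
    using g resolve_neg(1) unfolding agrees_with_def prod.case by blast
qed

definition parts_of :: "'a state \<Rightarrow> 'a set set" where
  "parts_of = (\<lambda>(P, E, N, U). P)"

definition resolved :: "'a state \<Rightarrow> 'a set set" where
  "resolved = (\<lambda>(P, E, N, U). E \<union> N)"

lemma step_parts_or_resolved:
  "construction_step s s' \<Longrightarrow> resolved s \<subseteq> resolved s' \<and> (parts_of s = parts_of s' \<or> resolved s = resolved s')"
  by (induction rule: construction_step.induct) (auto simp: resolved_def parts_of_def)

lemma resolution_sequence_of_construction_sequence:
  assumes "is_graph G" and cs: "construction_sequence G ss"
  shows "resolution_sequence G (\<lambda>i. parts_of (ss ! i)) (\<lambda>i. resolved (ss ! i)) (length ss - 1)"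
proof -
  define M where "M = length ss - 1"
  have ne: "ss \<noteq> []" and hd: "hd ss = initial_state (verts G)"
    and succ: "successively construction_step ss"
    using cs unfolding construction_sequence_def by auto
  obtain N where last: "last ss = ({verts G}, edges G, N, {})"
    using cs unfolding construction_sequence_def by auto
  have first: "ss ! 0 = initial_state (verts G)"
    using hd ne by (simp add: hd_conv_nth)
  have final: "ss ! M = ({verts G}, edges G, N, {})"
    using last ne by (simp add: last_conv_nth M_def)
  have step: "construction_step (ss ! i) (ss ! Suc i)" if "i < M" for i
    using succ that by (auto simp: successively_conv_nth M_def)
  have valid: "valid_state (verts G) (ss ! i)" if "i \<le> M" for i
    using that
  proof (induction i)
    case 0
    then show ?case using first valid_state_initial by metis
  next
    case (Suc i)
    then show ?case using valid_state_step[OF step[of i]] by auto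
  qed
  have vM: "edges G \<union> N = all_pairs (verts G)"
    using valid[of M] final by (auto simp: valid_state_def)
  have agrees: "agrees_with G (ss ! i)" if "i \<le> M" for i
    using that
  proof (induction rule: inc_induct)
    case base
    have "N \<inter> edges G = {}" 
      using valid[of M] final by (auto simp: valid_state_def)
    then show ?case using vM final by (auto simp: agrees_with_def homogeneous_def all_pairs_def)
  next
    case (step n)
    then show ?case using agrees_with_step[OF \<open>\<And>i. i < M \<Longrightarrow> _\<close>] valid by auto
  qed
  show ?thesis
    unfolding M_def[symmetric]
  proof
    show "is_graph G" by fact
    show "partition_on (verts G) (parts_of (ss ! i))" if "i \<le> M" for i
      using valid[OF that] by (auto simp: valid_state_def parts_of_def split: prod.splits)
    show "parts_of (ss ! 0) = (\<lambda>v. {v}) ` verts G" "resolved (ss ! 0) = {}"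
      by (simp_all add: first initial_state_def parts_of_def resolved_def)
    show "parts_of (ss ! M) = {verts G}" "resolved (ss ! M) = all_pairs (verts G)"
      using vM by (simp_all add: final parts_of_def resolved_def)
    show "homogeneous G (parts_of (ss ! i)) (resolved (ss ! i))" if "i \<le> M" for i
      using agrees[OF that] by (auto simp: agrees_with_def parts_of_def resolved_def split: prod.splits)
    show "resolved (ss ! i) \<subseteq> resolved (ss ! Suc i)"
      "parts_of (ss ! i) = parts_of (ss ! Suc i) \<or> resolved (ss ! i) = resolved (ss ! Suc i)"
      if "i < M" for i
      using step_parts_or_resolved[OF step[OF that]] by auto
  qed
qed

section \<open>Construction sequences of optimal width\<close>

lemma construction_steps_list:
  assumes "construction_step\<^sup>*\<^sup>* s s'"
  shows "\<exists>ss. ss \<noteq> [] \<and> hd ss = s \<and> last ss = s' \<and> successively construction_step ss"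
  using assms
proof (induction rule: converse_rtranclp_induct)
  case base
  show ?case by (rule exI[of _ "[s']"]) auto
next
  case (step s t)
  then obtain ss where ss: "ss \<noteq> []" "hd ss = t" "last ss = s'" "successively construction_step ss"
    by blast
  then show ?case
    using step(1) by (intro exI[of _ "s # ss"]) (cases ss; auto)
qed

lemma resolve_all_pairs:
  assumes "is_graph G" and "S \<subseteq> all_pairs (verts G)"
  shows "construction_step\<^sup>*\<^sup>* (initial_state (verts G))
    ((\<lambda>v. {v}) ` verts G, S \<inter> edges G, S - edges G, all_pairs (verts G) - S)"
proof -
  have "finite (all_pairs (verts G))"
    using assms(1) unfolding all_pairs_def is_graph_def by auto
  then have "finite S"
    using assms(2) finite_subset by blast
  then show ?thesis
    using assms(2)
  proof (induction S)
    case empty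
    then show ?case by (simp add: initial_state_def)
  next
    case (insert e S)
    let ?P = "(\<lambda>v. {v}) ` verts G" and ?U = "all_pairs (verts G) - S"
    obtain a b where ab: "e = {a, b}" "a \<noteq> b" "a \<in> verts G" "b \<in> verts G"
      using insert.prems by (auto simp: all_pairs_def card_2_iff)
    have pb: "pairs_between {a} {b} = {e}"
      using ab unfolding pairs_between_def by auto
    have e: "?U \<inter> {e} = {e}"
      using insert by auto
    have P: "{a} \<in> ?P" "{b} \<in> ?P"
      using ab by auto
    have "construction_step (?P, S \<inter> edges G, S - edges G, ?U)
      (?P, insert e S \<inter> edges G, insert e S - edges G, all_pairs (verts G) - insert e S)"
    proof (cases "e \<in> edges G")
      case True
      then have "(S \<inter> edges G) \<union> {e} = insert e S \<inter> edges G" "insert e S - edges G = S - edges G"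
        by auto
      moreover have "?U - {e} = all_pairs (verts G) - insert e S"
        by auto
      ultimately show ?thesis
        using construction_step.resolve_pos[OF P, of "S \<inter> edges G" "S - edges G" ?U]
        unfolding pb e by simp
    next
      case False
      then have "insert e S \<inter> edges G = S \<inter> edges G" "(S - edges G) \<union> {e} = insert e S - edges G"
        by auto
      moreover have "?U - {e} = all_pairs (verts G) - insert e S"
        by auto
      ultimately show ?thesis
        using construction_step.resolve_neg[OF P, of "S \<inter> edges G" "S - edges G" ?U]
        unfolding pb e by simp
    qed
    then show ?case
      using insert by (auto intro: rtranclp.rtrancl_into_rtrancl)
  qed
qed

lemma merge_all_parts:
  assumes "partition_on V P" and "finite P" and "P \<noteq> {}"
  shows "construction_step\<^sup>*\<^sup>* (P, E, N, U) ({V}, E, N, U)"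
  using assms
proof (induction "card P" arbitrary: P rule: less_induct)
  case less
  show ?case
  proof (cases "\<exists>A\<in>P. \<exists>B\<in>P. A \<noteq> B")
    case True
    then obtain A B where AB: "A \<in> P" "B \<in> P" "A \<noteq> B"
      by blast
    let ?P' = "insert (A \<union> B) (P - {A, B})"
    have "card (P - {A, B}) = card P - 2"
      using AB less.prems(2) by (subst card_Diff_subset) auto
    moreover have "card {A, B} \<le> card P"
      using AB less.prems(2) by (intro card_mono) auto
    moreover have "card ?P' \<le> Suc (card (P - {A, B}))"
      using less.prems(2) by (simp add: card_insert_if)
    ultimately have "card ?P' < card P"
      using AB by simp
    then have "construction_step\<^sup>*\<^sup>* (?P', E, N, U) ({V}, E, N, U)"
      using less.hyps[of ?P'] partition_on_merge[OF less.prems(1) AB(1,2)] less.prems(2) by simp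
    then show ?thesis
      using construction_step.merge[OF AB, of E N U] converse_rtranclp_into_rtranclp by metis
  next
    case False
    then obtain A where "P = {A}"
      using less.prems(3) by blast
    then have "P = {V}"
      using partition_onD1[OF less.prems(1)] by simp
    then show ?thesis by simp
  qed
qed

lemma construction_sequence_exists:
  assumes "is_graph G" and "verts G \<noteq> {}"
  shows "\<exists>ss. construction_sequence G ss"
proof -
  let ?V = "verts G"
  have E: "all_pairs ?V \<inter> edges G = edges G"
    using assms unfolding is_graph_def by auto
  have "partition_on ?V ((\<lambda>v. {v}) ` ?V)" "finite ((\<lambda>v. {v}) ` ?V)"
    using assms by (auto intro!: partition_onI simp: disjnt_def is_graph_def)
  then have "construction_step\<^sup>*\<^sup>* (initial_state ?V) ({?V}, edges G, all_pairs ?V - edges G, {})"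
    using resolve_all_pairs[OF assms(1) subset_refl]
      merge_all_parts[of ?V "(\<lambda>v. {v}) ` ?V" "edges G" "all_pairs ?V - edges G" "{}"] assms(2) E
    by (auto intro: rtranclp_trans)
  then show ?thesis
    using construction_steps_list unfolding construction_sequence_def by blast
qed

lemma radius_width_le_exists:
  assumes "finite (verts G)"
  shows "\<exists>k. radius_width_le r G ss k"
proof -
  let ?f = "\<lambda>s v. card {A \<in> parts_of s. \<exists>w\<in>A. within_dist (verts G, resolved s) r v w}"
  let ?S = "(\<lambda>(s, v). ?f s v) ` (set ss \<times> verts G)"
  have "finite ?S"
    using assms by auto
  then have "\<forall>s\<in>set ss. \<forall>v\<in>verts G. ?f s v \<le> Max ?S"
    by (auto intro!: Max_ge)
  then show ?thesis
    unfolding radius_width_le_def parts_of_def resolved_def by fastforce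
qed

text \<open>Merge-width is a least width of widths that are themselves defined as least bounds, so both minima
  have to be seen to exist before they can be used.\<close>

lemma merge_width_attained:
  assumes "is_graph G" and "verts G \<noteq> {}"
  obtains P R M where "resolution_sequence G P R M"
    and "\<And>i. i \<le> M \<Longrightarrow> width_bound (verts G) r (merge_width r G) (P i) (R i)"
proof -
  have "\<exists>k ss. construction_sequence G ss \<and> k = radius_width r G ss"
    using construction_sequence_exists[OF assms] by blast
  then have "\<exists>ss. construction_sequence G ss \<and> merge_width r G = radius_width r G ss"
    unfolding merge_width_def by (rule LeastI_ex)
  then obtain ss where ss: "construction_sequence G ss" "merge_width r G = radius_width r G ss"
    by blast
  have "finite (verts G)"
    using assms(1) unfolding is_graph_def by auto
  then have le: "radius_width_le r G ss (merge_width r G)"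
    unfolding ss(2) radius_width_def by (rule LeastI_ex[OF radius_width_le_exists])
  show ?thesis
  proof (rule that[OF resolution_sequence_of_construction_sequence[OF assms(1) ss(1)]])
    fix i assume "i \<le> length ss - 1"
    moreover have "ss \<noteq> []"
      using ss(1) unfolding construction_sequence_def by auto
    ultimately have "i < length ss"
      by (cases ss) auto
    then have "ss ! i \<in> set ss"
      by (rule nth_mem)
    then show "width_bound (verts G) r (merge_width r G) (parts_of (ss ! i)) (resolved (ss ! i))"
      using le unfolding radius_width_le_def width_bound_def parts_of_def resolved_def
      by (auto split: prod.splits)
  qed
qed

section \<open>Confining flips\<close>

text \<open>The \<open>P\<close>-flips where \<open>P\<close> consists of the fibers of a labelling \<open>c\<close>, and the flipped pairs of parts
  are given by a symmetric relation on labels.\<close>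

lemma flip_by_labels:
  fixes c :: "'a \<Rightarrow> 'l" and f :: "'l \<Rightarrow> 'l \<Rightarrow> bool"
  assumes "is_graph G" and sym: "\<And>p q. f p q = f q p" and "card (c ` verts G) \<le> k"
  defines "H \<equiv> {e \<in> all_pairs (verts G). \<exists>x y. e = {x, y} \<and> ({x, y} \<in> edges G) \<noteq> f (c x) (c y)}"
  shows "k_flip k G (verts G, H)"
proof -
  let ?V = "verts G"
  define fiber where "fiber p = {x \<in> ?V. c x = p}" for p
  have fin: "finite ?V" and sub: "edges G \<subseteq> all_pairs ?V"
    using assms(1) unfolding is_graph_def by auto
  have "partition_on ?V (fiber ` c ` ?V)"
    by (rule partition_onI) (auto simp: fiber_def disjnt_def)
  moreover have "card (fiber ` c ` ?V) \<le> k"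
    using card_image_le[of "c ` ?V" fiber] fin assms(3) by simp
  moreover have "partition_flip (fiber ` c ` ?V) G (?V, H)"
    unfolding partition_flip_def fst_conv snd_conv
  proof (intro conjI ballI)
    show "is_graph (?V, H)"
      using fin unfolding is_graph_def H_def by auto
    fix A B assume "A \<in> fiber ` c ` ?V" "B \<in> fiber ` c ` ?V"
    then obtain p q where pq: "A = fiber p" "B = fiber q"
      by auto
    have iff: "{x, y} \<in> H \<longleftrightarrow> ({x, y} \<in> edges G) \<noteq> f p q" if "x \<in> A" "y \<in> B" "x \<noteq> y" for x y
    proof -
      have "c x = p" "c y = q" "{x, y} \<in> all_pairs ?V"
        using that pq by (auto simp: fiber_def all_pairs_def)
      then show ?thesis
        unfolding H_def using sym by (auto simp: doubleton_eq_iff insert_commute)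
    qed
    show "H \<inter> pairs_between A B = edges G \<inter> pairs_between A B \<or>
      H \<inter> pairs_between A B = pairs_between A B - edges G"
    proof (cases "f p q")
      case True
      then have "H \<inter> pairs_between A B = pairs_between A B - edges G"
        using iff unfolding pairs_between_def by blast
      then show ?thesis ..
    next
      case False
      then have "H \<inter> pairs_between A B = edges G \<inter> pairs_between A B"
        using iff unfolding pairs_between_def by blast
      then show ?thesis ..
    qed
  qed simp
  ultimately show ?thesis
    unfolding k_flip_def by blast
qed

text \<open>Vertices of \<open>A\<close> itself contribute no trace; this keeps a shattered subset of \<open>A\<close> disjoint from the
  vertices that shatter it, so that both form the two sides of a bipartite pattern.\<close>

definition traces :: "'a graph \<Rightarrow> 'a set \<Rightarrow> 'a set set" where
  "traces G A = (\<lambda>b. {a \<in> A. {a, b} \<in> edges G}) ` (verts G - A)"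

text \<open>\<open>R\<close> is meant to be the resolved set of the state that flipper moves to, and \<open>R'\<close> that of the state
  flipper comes from. The parts meeting the ball of radius \<open>m + 1\<close> get a label each, and a vertex in
  any other part is labelled by its adjacency to representatives of the parts meeting the ball of
  radius \<open>m\<close>. These labels suffice: if \<open>y\<close> lies outside the larger set of parts and the
  representative \<open>a\<close> of a part \<open>A\<close> lies in the smaller ball, then \<open>{a, y}\<close> is not in \<open>R\<close>, as
  otherwise \<open>y\<close> would have distance at most \<open>m + 1\<close>. By homogeneity the adjacency of \<open>a\<close> and \<open>y\<close>
  then decides all unresolved pairs between \<open>A\<close> and \<open>y\<close>.\<close>

lemma confining_flip:
  assumes G: "is_graph G" and part: "partition_on (verts G) P"
    and hom: "homogeneous G P R" and RR': "R \<subseteq> R'" 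
    and width: "card {A \<in> P. \<exists>w\<in>A. within_dist (verts G, R') (Suc m) v w} \<le> k"
    and tr: "\<And>A. A \<subseteq> verts G \<Longrightarrow> card A \<le> k \<Longrightarrow> card (traces G A) \<le> N"
  shows "\<exists>H. k_flip (k + N) G (verts G, H) \<and>
    (\<forall>x y. within_dist (verts G, R') m v x \<longrightarrow> {x, y} \<in> H \<longrightarrow> {x, y} \<in> R)"
proof -
  let ?V = "verts G"
  define ball where "ball n = {w. within_dist (?V, R') n v w}" for n
  define near where "near = {A \<in> P. A \<inter> ball m \<noteq> {}}"
  define near' where "near' = {A \<in> P. A \<inter> ball (Suc m) \<noteq> {}}"
  have fin: "finite ?V" and sub: "edges G \<subseteq> all_pairs ?V"
    using G unfolding is_graph_def by auto
  have PV: "\<Union> P = ?V"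
    using partition_onD1[OF part] by simp
  then have finP: "finite P"
    using fin finite_UnionD by metis
  have eq: "A = B" if "A \<in> P" "B \<in> P" "x \<in> A" "x \<in> B" for A B x
    using partition_onD2[OF part] that unfolding disjoint_def by auto
  have "ball m \<subseteq> ball (Suc m)"
    unfolding ball_def using within_dist_mono_radius by fastforce
  then have nn: "near \<subseteq> near'"
    unfolding near_def near'_def by blast
  have fin': "finite near'"
    using finP unfolding near'_def by simp
  have card': "card near' \<le> k"
  proof -
    have "near' = {A \<in> P. \<exists>w\<in>A. within_dist (?V, R') (Suc m) v w}"
      unfolding near'_def ball_def by auto
    then show ?thesis
      using width by simp
  qed
  have ballV: "ball n \<subseteq> ?V" for n
    using within_dist_verts unfolding ball_def by fastforce
  obtain pt where pt: "\<And>x. x \<in> ?V \<Longrightarrow> pt x \<in> P \<and> x \<in> pt x"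
  proof -
    have "\<forall>x\<in>?V. \<exists>A. A \<in> P \<and> x \<in> A"
      using PV by auto
    then show ?thesis
      using that by metis
  qed
  obtain rep where rep: "\<And>A. A \<in> near \<Longrightarrow> rep A \<in> A \<inter> ball m"
  proof -
    have "\<forall>A\<in>near. \<exists>a. a \<in> A \<inter> ball m"
      unfolding near_def by auto
    then show ?thesis
      using that by metis
  qed
  define S where "S = rep ` near"
  have SV: "S \<subseteq> ?V"
    using rep ballV unfolding S_def by blast
  have "card S \<le> card near"
    unfolding S_def using fin' nn finite_subset card_image_le by blast
  also have "\<dots> \<le> k"
    using card_mono[OF fin' nn] card' by simp
  finally have trS: "card (traces G S) \<le> N"
    using tr SV by blast
  define c where "c x = (if pt x \<in> near' then Inl (pt x) else Inr {a \<in> S. {a, x} \<in> edges G})" for x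
  \<comment> \<open>A far vertex is not a representative, so its label is a trace of a vertex outside \<open>S\<close>, and
    there are at most \<open>N\<close> of these.\<close>
  have "c ` ?V \<subseteq> Inl ` near' \<union> Inr ` traces G S"
  proof
    fix l assume "l \<in> c ` ?V"
    then obtain x where x: "x \<in> ?V" "l = c x"
      by blast
    have "x \<notin> S" if "pt x \<notin> near'"
    proof
      assume "x \<in> S"
      then obtain A where A: "A \<in> near" "x = rep A"
        unfolding S_def by blast
      then have "pt x = A"
        using rep[OF A(1)] pt[OF x(1)] eq[of "pt x" A x] near_def by auto
      then show False
        using A nn that by blast
    qed
    then show "l \<in> Inl ` near' \<union> Inr ` traces G S"
      using x unfolding c_def traces_def by auto
  qed
  moreover have fintr: "finite (traces G S)"
    using fin unfolding traces_def by simp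
  ultimately have "card (c ` ?V) \<le> card (Inl ` near' \<union> Inr ` traces G S)"
    using fin' by (intro card_mono) auto
  also have "\<dots> \<le> card near' + card (traces G S)"
    using card_Un_le[of "Inl ` near'" "Inr ` traces G S"] by (simp add: card_image)
  finally have cardc: "card (c ` ?V) \<le> k + N"
    using card' trS by simp

  \<comment> \<open>As long as one end is near, the labels decide how an unresolved pair is resolved.\<close>
  have same: "{x, y} \<in> edges G \<longleftrightarrow> {x', y'} \<in> edges G"
    if V: "x \<in> ?V" "y \<in> ?V" "x' \<in> ?V" "y' \<in> ?V" and c: "c x = c x'" "c y = c y'"
      and nx: "pt x \<in> near" and ne: "x \<noteq> y" "x' \<noteq> y'" and un: "{x, y} \<notin> R" "{x', y'} \<notin> R"
    for x y x' y'
  proof -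
    have px: "pt x' = pt x"
      using nx nn c(1) by (auto simp: c_def split: if_splits)
    show ?thesis
    proof (cases "pt y \<in> near'")
      case True
      then have "pt y' = pt y"
        using c(2) by (auto simp: c_def split: if_splits)
      then show ?thesis
        using hom pt V px ne un unfolding homogeneous_def by metis
    next
      case False
      then have far: "pt y' \<notin> near'" and tre: "{a \<in> S. {a, y} \<in> edges G} = {a \<in> S. {a, y'} \<in> edges G}"
        using c(2) by (auto simp: c_def split: if_splits)
      define a where "a = rep (pt x)"
      have a: "a \<in> pt x" "a \<in> ball m" "a \<in> S"
        using rep[OF nx] nx unfolding a_def S_def by auto
      have unres: "a \<noteq> z \<and> {a, z} \<notin> R" if z: "z \<in> ?V" "pt z \<notin> near'" for z
      proof -
        have "z \<notin> ball (Suc m)"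
          using z pt unfolding near'_def by blast
        then show ?thesis
          using a(2) within_dist_extend[of "(?V, R')" m v a z] RR' z(1) \<open>ball m \<subseteq> ball (Suc m)\<close>
          unfolding ball_def by auto
      qed
      have "{x, y} \<in> edges G \<longleftrightarrow> {a, y} \<in> edges G"
        using hom pt[OF V(1)] pt[OF V(2)] a(1) ne(1) un(1) unres[OF V(2) False] unfolding homogeneous_def by blast
      also have "\<dots> \<longleftrightarrow> {a, y'} \<in> edges G"
        using tre a(3) by blast
      also have "\<dots> \<longleftrightarrow> {x', y'} \<in> edges G"
        using hom pt[OF V(3)] pt[OF V(4)] px a(1) ne(2) un(2) unres[OF V(4) far] unfolding homogeneous_def
        by metis
      finally show ?thesis .
    qed
  qed

  \<comment> \<open>Two labels, one of them near, are flipped iff some unresolved pair between them is an edge; by \<open>same\<close> then all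
    unresolved pairs between them are. Two far labels are
    never flipped.\<close>
  define f where "f p q \<longleftrightarrow> (\<exists>x\<in>?V. \<exists>y\<in>?V. c x = p \<and> c y = q \<and> {x, y} \<notin> R \<and> {x, y} \<in> edges G \<and>
    (pt x \<in> near \<or> pt y \<in> near))" for p q
  have f_sym_imp: "f q p" if f: "f p q" for p q
  proof -
    obtain x y where "x \<in> ?V" "y \<in> ?V" "c x = p" "c y = q" "{x, y} \<notin> R" "{x, y} \<in> edges G"
      "pt x \<in> near \<or> pt y \<in> near"
      using f unfolding f_def by blast
    then have "c y = q \<and> c x = p \<and> {y, x} \<notin> R \<and> {y, x} \<in> edges G \<and> (pt y \<in> near \<or> pt x \<in> near)"
      by (simp add: insert_commute disj_commute)
    then show ?thesis
      unfolding f_def using \<open>x \<in> ?V\<close> \<open>y \<in> ?V\<close> by blast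
  qed
  have f_sym: "f p q = f q p" for p q
    using f_sym_imp by blast
  note flip = flip_by_labels[of G f, OF G f_sym cardc]
  show ?thesis
  proof (rule exI, rule conjI[OF flip], intro allI impI, rule ccontr)
    fix x y
    assume x: "within_dist (?V, R') m v x" and un: "{x, y} \<notin> R"
    assume H: "{x, y} \<in> {e \<in> all_pairs ?V. \<exists>x y. e = {x, y} \<and> ({x, y} \<in> edges G) \<noteq> f (c x) (c y)}"
    then have V: "x \<in> ?V" "y \<in> ?V" and ne: "x \<noteq> y"
      by (auto simp: all_pairs_def)
    have nx: "pt x \<in> near"
      using x pt[OF V(1)] unfolding near_def ball_def by blast
    have diff: "({x, y} \<in> edges G) \<noteq> f (c x) (c y)"
    proof -
      obtain x' y' where e: "{x, y} = {x', y'}" "({x', y'} \<in> edges G) \<noteq> f (c x') (c y')"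
        using H by blast
      then have "(x' = x \<and> y' = y) \<or> (x' = y \<and> y' = x)"
        by (auto simp: doubleton_eq_iff)
      then show ?thesis
        using e f_sym[of "c x" "c y"] by metis
    qed
    then have "f (c x) (c y)" "{x, y} \<notin> edges G"
      using V un nx unfolding f_def by blast+
    then obtain x' y' where w: "x' \<in> ?V" "y' \<in> ?V" "c x' = c x" "c y' = c y" "{x', y'} \<notin> R"
      "{x', y'} \<in> edges G"
      unfolding f_def by blast
    moreover have "x' \<noteq> y'"
      using w(6) sub by (auto simp: all_pairs_def)
    ultimately show False
      using same[of x y x' y'] V nx ne un \<open>{x, y} \<notin> edges G\<close> by simp
  qed
qed

section \<open>Playing the sequence backwards\<close>

context resolution_sequence
begin

text \<open>In round \<open>t\<close> flipper uses state \<open>M - t\<close>, which is state \<open>0\<close> from round \<open>M\<close> on. The invariant is that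
  runner's move from \<open>v t\<close> in the graph announced in round \<open>t\<close> stays within distance \<open>r\<close> along the
  pairs resolved in state \<open>M - t\<close>. Flipper announces that graph knowing only \<open>v (t - 1)\<close>, so it has
  to confine runner within the ball of radius \<open>2r\<close> around this vertex.\<close>

lemma flipper_wins:
  assumes "verts G \<noteq> {}"
    and width: "\<And>i. i \<le> M \<Longrightarrow> width_bound (verts G) (2 * r + 1) k (P i) (R i)"
    and tr: "\<And>A. A \<subseteq> verts G \<Longrightarrow> card A \<le> k \<Longrightarrow> card (traces G A) \<le> N"
  shows "flipper_wins r (k + N) G"
proof -
  let ?V = "verts G"
  \<comment> \<open>the state used in round \<open>t - 1\<close>, whose resolved pairs still govern the move to \<open>v t\<close>\<close>
  define j where "j t = M - (t - 1)" for t
  have confine: "\<exists>H. k_flip (k + N) G (?V, H) \<and>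
    (\<forall>x y. within_dist (?V, R (j t)) (2 * r) v x \<longrightarrow> {x, y} \<in> H \<longrightarrow> {x, y} \<in> R (M - t))"
    if v: "v \<in> ?V" for v t
  proof -
    have jt: "j t = M - t \<or> (M - t < M \<and> j t = Suc (M - t))"
      unfolding j_def by auto
    then have sub: "R (M - t) \<subseteq> R (j t)" and alt: "P (M - t) = P (j t) \<or> R (M - t) = R (j t)"
      using R_mono[of "M - t"] step[of "M - t"] by auto
    \<comment> \<open>Parts of one state meet a ball of the next one. As only one of the two
      changes in a step, the width of one of the two states bounds their number.\<close>
    have "card {A \<in> P (M - t). \<exists>w\<in>A. within_dist (?V, R (j t)) (Suc (2 * r)) v w} \<le> k"
      using alt width[of "j t"] width[of "M - t"] v unfolding width_bound_def j_def by auto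
    then show ?thesis
      using confining_flip[OF graph part homog sub _ tr] by simp
  qed
  then obtain H where H: "\<And>v t. v \<in> ?V \<Longrightarrow> k_flip (k + N) G (?V, H v t)"
    "\<And>v t x y. v \<in> ?V \<Longrightarrow> within_dist (?V, R (j t)) (2 * r) v x \<Longrightarrow> {x, y} \<in> H v t \<Longrightarrow> {x, y} \<in> R (M - t)"
    by metis
  define \<sigma> where "\<sigma> h = (?V, H (last h) (length h))" for h
  have legal: "legal_strategy (k + N) G \<sigma>"
    unfolding legal_strategy_def \<sigma>_def using H(1) by (metis last_in_set subsetD)
  have "\<exists>t\<ge>1. isolated (played_graph G \<sigma> v t) (v t)" if play: "runner_play r G \<sigma> v" for v
  proof -
    have vV: "v t \<in> ?V" for t
      using play unfolding runner_play_def by (cases "t = 0") auto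
    have move: "within_dist (played_graph G \<sigma> v t) r (v t) (v (Suc t))" for t
    proof -
      have "within_dist (played_graph G \<sigma> v (Suc t - 1)) r (v (Suc t - 1)) (v (Suc t))"
        using play unfolding runner_play_def by (metis One_nat_def Suc_le_mono zero_le)
      then show ?thesis by simp
    qed
    have pl: "played_graph G \<sigma> v (Suc t) = (?V, H (v t) (Suc t))" for t
      unfolding played_graph_def \<sigma>_def by simp
    have reach: "within_dist (?V, R (M - t)) r (v t) (v (Suc t))" for t
    proof (induction t)
      case 0
      have "edges G \<subseteq> all_pairs ?V"
        using graph unfolding is_graph_def by auto
      then have "{x, y} \<in> R M" if "{x, y} \<in> edges G" for x y
        using that R_M by auto
      then show ?case
        using move[of 0] within_dist_confined[of ?V "edges G" r "v 0" "v 1" "R M" "v 0" "R M"]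
          within_dist_refl[of "v 0" "(?V, R M)" r] vV by (simp add: played_graph_def)
    next
      case (Suc t)
      have jt: "j (Suc t) = M - t" "R (M - Suc t) \<subseteq> R (M - t)"
        using R_mono[of "M - Suc t"] unfolding j_def by (cases "t < M"; auto simp: Suc_diff_Suc)+
      show ?case
        using within_dist_confined[of ?V "H (v t) (Suc t)" r "v (Suc t)" "v (Suc (Suc t))",
            OF _ Suc jt(2)] move[of "Suc t"] H(2)[OF vV, of "Suc t" t] unfolding pl jt(1) by blast
    qed
    have "isolated (played_graph G \<sigma> v (Suc M)) (v (Suc M))"
      unfolding isolated_def pl snd_conv
    proof (intro ballI notI)
      fix e assume e: "e \<in> H (v M) (Suc M)" "v (Suc M) \<in> e"
      have "is_graph (?V, H (v M) (Suc M))"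
        using H(1)[OF vV] unfolding k_flip_def partition_flip_def by auto
      then have "card e = 2"
        using e unfolding is_graph_def all_pairs_def by auto
      then obtain y where y: "e = {v (Suc M), y}"
        using e(2) by (auto simp: card_2_iff)
      have "within_dist (?V, R (j (Suc M))) (2 * r) (v M) (v (Suc M))"
        using within_dist_mono_radius[OF reach[of M]] unfolding j_def by simp
      then have "e \<in> R 0"
        using H(2)[OF vV, of "Suc M" M "v (Suc M)" y] e(1) y by simp
      then show False
        using R_0 by simp
    qed
    then show ?thesis
      by (intro exI[of _ "Suc M"]) simp
  qed
  then show ?thesis
    unfolding flipper_wins_def using legal by blast
qed

text \<open>The resolved neighbours of \<open>u\<close> in \<open>Z\<close> lie in pairwise different parts, each within distance 1 of \<open>u\<close>.\<close>

lemma resolved_degree_le: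
  assumes width: "width_bound (verts G) 1 k (P i) (R i)" and "i \<le> M"
    and Z: "Z \<subseteq> verts G" and u: "u \<in> verts G"
    and sep: "\<And>C y z. C \<in> P i \<Longrightarrow> y \<in> C \<Longrightarrow> z \<in> C \<Longrightarrow> y \<in> Z \<Longrightarrow> z \<in> Z \<Longrightarrow> y = z"
  shows "card {y \<in> Z. {u, y} \<in> R i} \<le> k"
proof -
  let ?V = "verts G"
  let ?N = "{y \<in> Z. {u, y} \<in> R i}"
  let ?Q = "{A \<in> P i. \<exists>w\<in>A. within_dist (?V, R i) 1 u w}"
  have PV: "\<Union> (P i) = ?V"
    using partition_onD1[OF part[OF assms(2)]] by simp
  have "finite ?V"
    using graph unfolding is_graph_def by simp
  then have fin: "finite (P i)"
    using PV finite_UnionD by metis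
  have "\<forall>y\<in>?V. \<exists>A. A \<in> P i \<and> y \<in> A"
    using PV by auto
  then obtain pt where pt: "\<And>y. y \<in> ?V \<Longrightarrow> pt y \<in> P i \<and> y \<in> pt y"
    by metis
  have "inj_on pt ?N"
  proof (rule inj_onI)
    fix y z assume yz: "y \<in> ?N" "z \<in> ?N" "pt y = pt z"
    then have "y \<in> ?V" "z \<in> ?V"
      using Z by blast+
    then show "y = z"
      using sep[of "pt y" y z] pt[of y] pt[of z] yz by simp
  qed
  moreover have "pt ` ?N \<subseteq> ?Q"
  proof
    fix A assume "A \<in> pt ` ?N"
    then obtain y where y: "y \<in> Z" "{u, y} \<in> R i" "A = pt y"
      by blast
    then have "within_dist (?V, R i) 1 u y"
      using within_dist_extend[of "(?V, R i)" 0 u u y] within_dist_refl[of u "(?V, R i)" 0] u Z by auto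
    then show "A \<in> ?Q"
      using pt[of y] y Z by auto
  qed
  ultimately have "card ?N \<le> card ?Q"
    using fin by (intro card_inj_on_le) auto
  then show ?thesis
    using width u unfolding width_bound_def by fastforce
qed

text \<open>Consider the step that first puts two vertices \<open>u\<close> and \<open>u'\<close> of the same side into one part. It is a
  merge, so it resolves nothing, and after it homogeneity forces that every vertex \<open>y\<close> on which
  \<open>u\<close> and \<open>u'\<close> differ has been resolved with \<open>u\<close> or with \<open>u'\<close>. Before it every part contains at most
  one vertex of each side, so \<open>u\<close> and \<open>u'\<close> have at most \<open>k\<close> resolved neighbours \<open>y\<close> each.\<close>

lemma width_ge_half_difference:
  assumes V: "verts G = X \<union> Y"
    and width: "\<And>i. i \<le> M \<Longrightarrow> width_bound (verts G) 1 k (P i) (R i)"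
    and X: "\<And>u u'. u \<in> X \<Longrightarrow> u' \<in> X \<Longrightarrow> u \<noteq> u' \<Longrightarrow>
      D \<le> card {y \<in> Y. ({u, y} \<in> edges G) \<noteq> ({u', y} \<in> edges G)}"
    and Y: "\<And>u u'. u \<in> Y \<Longrightarrow> u' \<in> Y \<Longrightarrow> u \<noteq> u' \<Longrightarrow>
      D \<le> card {x \<in> X. ({u, x} \<in> edges G) \<noteq> ({u', x} \<in> edges G)}"
    and XY: "X \<inter> Y = {}" and ne: "x \<in> X" "x' \<in> X" "x \<noteq> x'"
  shows "D \<le> 2 * k"
proof -
  define clash where "clash i \<longleftrightarrow>
    (\<exists>C\<in>P i. \<exists>u\<in>C. \<exists>u'\<in>C. u \<noteq> u' \<and> (u \<in> X \<and> u' \<in> X \<or> u \<in> Y \<and> u' \<in> Y))" for i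
  have "\<not> clash 0"
    unfolding clash_def P_0 by auto
  moreover have "clash M"
    unfolding clash_def P_M V using ne by auto
  ultimately obtain i where i: "i < M" "\<not> clash i" "clash (Suc i)"
    using ex_least_nat_less[of clash M] by blast
  then have R: "R i = R (Suc i)"
    using step[OF i(1)] unfolding clash_def by auto
  have deg: "card {y \<in> Z. {u, y} \<in> R i} \<le> k" if "Z = X \<or> Z = Y" "u \<in> verts G" for Z u
    by (rule resolved_degree_le[OF width]) (use that i V in \<open>auto simp: clash_def\<close>)
  obtain C u u' where C: "C \<in> P (Suc i)" "u \<in> C" "u' \<in> C" "u \<noteq> u'"
    and side: "u \<in> X \<and> u' \<in> X \<or> u \<in> Y \<and> u' \<in> Y"
    using i(3) unfolding clash_def by blast
  have PV: "\<Union> (P (Suc i)) = verts G"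
    using partition_onD1[OF part[of "Suc i"]] i(1) by simp
  have fin: "finite (verts G)"
    using graph unfolding is_graph_def by simp
  have main: "D \<le> 2 * k"
    if Z: "Z = X \<or> Z = Y" "u \<notin> Z" "u' \<notin> Z"
      and D: "D \<le> card {y \<in> Z. ({u, y} \<in> edges G) \<noteq> ({u', y} \<in> edges G)}" for Z
  proof -
    have u: "u \<in> verts G" "u' \<in> verts G"
      using C PV by auto
    have ZV: "Z \<subseteq> verts G"
      using Z V by auto
    have "{y \<in> Z. ({u, y} \<in> edges G) \<noteq> ({u', y} \<in> edges G)}
      \<subseteq> {y \<in> Z. {u, y} \<in> R i} \<union> {y \<in> Z. {u', y} \<in> R i}"
    proof (rule ccontr)
      assume "\<not> ?thesis"
      then obtain y where y: "y \<in> Z" "({u, y} \<in> edges G) \<noteq> ({u', y} \<in> edges G)"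
        "{u, y} \<notin> R i" "{u', y} \<notin> R i"
        by blast
      obtain B where B: "B \<in> P (Suc i)" "y \<in> B"
        using y(1) ZV PV by blast
      have "u \<noteq> y" "u' \<noteq> y"
        using y(1) Z by auto
      moreover have "homogeneous G (P (Suc i)) (R i)"
        using homog[of "Suc i"] i(1) R by simp
      ultimately show False
        using C B y unfolding homogeneous_def by blast
    qed
    then have "card {y \<in> Z. ({u, y} \<in> edges G) \<noteq> ({u', y} \<in> edges G)}
      \<le> card ({y \<in> Z. {u, y} \<in> R i} \<union> {y \<in> Z. {u', y} \<in> R i})"
      using fin ZV by (intro card_mono) (auto intro: finite_subset)
    also have "\<dots> \<le> card {y \<in> Z. {u, y} \<in> R i} + card {y \<in> Z. {u', y} \<in> R i}"
      by (rule card_Un_le)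
    also have "\<dots> \<le> 2 * k"
      using deg[OF Z(1) u(1)] deg[OF Z(1) u(2)] by simp
    finally show ?thesis
      using D by simp
  qed
  show ?thesis
    using side
  proof
    assume "u \<in> X \<and> u' \<in> X"
    then show ?thesis
      using main[of Y] X[of u u'] C(4) XY by blast
  next
    assume "u \<in> Y \<and> u' \<in> Y"
    then show ?thesis
      using main[of X] Y[of u u'] C(4) XY by blast
  qed
qed

end

section \<open>Shattered sets\<close>

definition shatters :: "'a set set \<Rightarrow> 'a set \<Rightarrow> bool" where
  "shatters F S \<longleftrightarrow> (\<forall>T\<subseteq>S. \<exists>X\<in>F. X \<inter> S = T)"

text \<open>The bound in the form of a power admits a direct induction. Delete \<open>x\<close> from the members of \<open>F\<close>; the
  sets obtained twice form a family that shatters no set of size \<open>d - 1\<close>, since adding \<open>x\<close> to a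
  set it shatters gives a set shattered by \<open>F\<close>.\<close>

lemma sauer_shelah:
  assumes "finite A" and "F \<subseteq> Pow A" and "\<And>S. S \<subseteq> A \<Longrightarrow> card S = d \<Longrightarrow> \<not> shatters F S"
  shows "card F \<le> (card A + 1) ^ d"
  using assms
proof (induction A arbitrary: F d rule: finite_induct)
  case empty
  then have "F \<subseteq> {{}}"
    by simp
  then have "card F \<le> card {{} :: 'a set}"
    by (rule card_mono[rotated]) simp
  then show ?case by simp
next
  case (insert x A)
  show ?case
  proof (cases d)
    case 0
    then have "F = {}"
      using insert.prems(2)[of "{}"] unfolding shatters_def by auto
    then show ?thesis by simp
  next
    case (Suc e)
    define F0 where "F0 = {X \<in> F. x \<notin> X}"
    define F1 where "F1 = {X \<in> F. x \<in> X}"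
    define F1' where "F1' = (\<lambda>X. X - {x}) ` F1"
    have fin: "finite F"
      using insert.prems(1) insert.hyps(1) by (auto intro: finite_subset)
    have "inj_on (\<lambda>X. X - {x}) F1"
      unfolding F1_def by (auto simp: inj_on_def)
    then have c1: "card F1' = card F1"
      unfolding F1'_def by (rule card_image)
    have "F = F0 \<union> F1" "F0 \<inter> F1 = {}"
      unfolding F0_def F1_def by auto
    then have "card F = card F0 + card F1"
      using fin by (metis card_Un_disjoint finite_Un)
    also have "\<dots> = card (F0 \<union> F1') + card (F0 \<inter> F1')"
      using card_Un_Int[of F0 F1'] fin c1 unfolding F0_def F1'_def F1_def by simp
    also have "card (F0 \<union> F1') \<le> (card A + 1) ^ d"
    proof (rule insert.IH)
      show "F0 \<union> F1' \<subseteq> Pow A"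
        using insert.prems(1) unfolding F0_def F1'_def F1_def by auto
      fix S assume S: "S \<subseteq> A" "card S = d"
      have "shatters F S" if sh: "shatters (F0 \<union> F1') S"
        unfolding shatters_def
      proof (intro allI impI)
        fix T assume "T \<subseteq> S"
        then obtain X where X: "X \<in> F0 \<union> F1'" "X \<inter> S = T"
          using sh unfolding shatters_def by blast
        then obtain X' where "X' \<in> F" "X = X' \<or> X = X' - {x}"
          unfolding F0_def F1'_def F1_def by auto
        then show "\<exists>X\<in>F. X \<inter> S = T"
          using X(2) S(1) insert.hyps(2) by (intro bexI[of _ X']) auto
      qed
      then show "\<not> shatters (F0 \<union> F1') S"
        using insert.prems(2)[of S] S by auto
    qed
    also have "card (F0 \<inter> F1') \<le> (card A + 1) ^ e"
    proof (rule insert.IH)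
      show "F0 \<inter> F1' \<subseteq> Pow A"
        using insert.prems(1) unfolding F0_def by auto
      fix S assume S: "S \<subseteq> A" "card S = e"
      have "shatters F (insert x S)" if sh: "shatters (F0 \<inter> F1') S"
        unfolding shatters_def
      proof (intro allI impI)
        fix T assume "T \<subseteq> insert x S"
        then have "T - {x} \<subseteq> S"
          by blast
        then obtain X where X: "X \<in> F0" "X \<in> F1'" "X \<inter> S = T - {x}"
          using sh unfolding shatters_def by blast
        obtain X' where "X' \<in> F" "x \<in> X'" "X = X' - {x}"
          using X(2) unfolding F1'_def F1_def by blast
        then have F: "x \<notin> X" "X \<in> F" "insert x X \<in> F"
          using X(1) unfolding F0_def by (simp_all add: insert_absorb)
        show "\<exists>X\<in>F. X \<inter> insert x S = T"
        proof (cases "x \<in> T")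
          case True
          then have "insert x X \<inter> insert x S = T"
            using X(3) by auto
          then show ?thesis
            using F(3) by blast
        next
          case False
          then have "X \<inter> insert x S = T"
            using X(3) F(1) by auto
          then show ?thesis
            using F(2) by blast
        qed
      qed
      moreover have "x \<notin> S" "finite S"
        using S insert.hyps finite_subset by blast+
      then have "card (insert x S) = d" "insert x S \<subseteq> insert x A"
        using S Suc by auto
      ultimately show "\<not> shatters (F0 \<inter> F1') S"
        using insert.prems(2)[of "insert x S"] by auto
    qed
    also have "(card A + 1) ^ d + (card A + 1) ^ e = (card A + 1) ^ e * (card A + 2)"
      unfolding Suc by (simp add: algebra_simps)
    also have "\<dots> \<le> (card A + 2) ^ e * (card A + 2)"
      by (intro mult_right_mono power_mono) auto
    also have "\<dots> = (card (insert x A) + 1) ^ d"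
      using insert.hyps Suc by simp
    finally show ?thesis by simp
  qed
qed

section \<open>Rook graphs\<close>

definition rook :: "nat \<times> nat \<Rightarrow> nat \<times> nat \<Rightarrow> bool" where
  "rook p z \<longleftrightarrow> fst p = fst z \<or> snd p = snd z"

text \<open>If the cells lie in different rows, then the cells in the row of \<open>p\<close> are seen from \<open>p\<close> but, apart
  from the columns of \<open>p\<close> and \<open>p'\<close>, not from \<open>p'\<close>. Likewise for columns.\<close>

lemma rook_difference:
  assumes "p \<in> {..<q} \<times> {..<q}" and "p' \<in> {..<q} \<times> {..<q}" and "p \<noteq> p'"
  shows "q - 2 \<le> card {z \<in> {..<q} \<times> {..<q}. rook p z \<noteq> rook p' z}"
proof -
  obtain i j i' j' where p: "p = (i, j)" "p' = (i', j')"
    by (metis surj_pair)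
  have card: "q - 2 \<le> card ({..<q} - {a, b})" for a b
  proof -
    have "card {a, b} \<le> 2"
      by (simp add: card_insert_if)
    then show ?thesis
      using diff_card_le_card_Diff[of "{a, b}" "{..<q}"] by simp
  qed
  show ?thesis
  proof (cases "i = i'")
    case False
    have "(\<lambda>l. (i, l)) ` ({..<q} - {j, j'}) \<subseteq> {z \<in> {..<q} \<times> {..<q}. rook p z \<noteq> rook p' z}"
      using False assms p unfolding rook_def by auto
    then have "card ((\<lambda>l. (i, l)) ` ({..<q} - {j, j'})) \<le> card {z \<in> {..<q} \<times> {..<q}. rook p z \<noteq> rook p' z}"
      by (rule card_mono[rotated]) simp
    then show ?thesis
      using card[of j j'] by (subst (asm) card_image) (auto simp: inj_on_def)
  next
    case True
    then have "j \<noteq> j'"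
      using assms(3) p by simp
    then have "(\<lambda>l. (l, j)) ` ({..<q} - {i, i'}) \<subseteq> {z \<in> {..<q} \<times> {..<q}. rook p z \<noteq> rook p' z}"
      using assms p unfolding rook_def by auto
    then have "card ((\<lambda>l. (l, j)) ` ({..<q} - {i, i'})) \<le> card {z \<in> {..<q} \<times> {..<q}. rook p z \<noteq> rook p' z}"
      by (rule card_mono[rotated]) simp
    then show ?thesis
      using card[of i i'] by (subst (asm) card_image) (auto simp: inj_on_def)
  qed
qed

lemma rook_sym: "rook p z = rook z p"
  unfolding rook_def by auto

text \<open>Place the elements of \<open>S\<close> on the cells of the board by \<open>\<phi>\<close>. For every cell \<open>z\<close>, shattering provides a
  vertex \<open>b z\<close> outside \<open>A\<close> that sees exactly those elements of \<open>S\<close> whose cell is attacked from \<open>z\<close>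
  (or equals it).
  Edges inside the two sides are arbitrary, which does not affect the lower bound.\<close>

lemma shattered_imp_rook_subgraph:
  assumes G: "is_graph G" and A: "A \<subseteq> verts G" and S: "S \<subseteq> A" "card S = q ^ 2"
    and sh: "shatters (traces G A) S" and q: "q \<ge> 3"
  shows "\<exists>W \<subseteq> verts G. card W = 2 * q ^ 2 \<and> q - 2 \<le> 2 * merge_width 1 (induced_subgraph G W)"
proof -
  let ?g = "{..<q} \<times> {..<q}"
  have finV: "finite (verts G)"
    using G unfolding is_graph_def by simp
  have finS: "finite S"
    by (rule finite_subset[OF subset_trans[OF S(1) A] finV])
  have "card S = card ?g"
    using S(2) by (simp add: power2_eq_square)
  then obtain \<phi> where \<phi>: "bij_betw \<phi> S ?g"
    using finite_same_card_bij[OF finS, of ?g] by auto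
  have \<phi>_in: "\<phi> a \<in> ?g" if "a \<in> S" for a
    using bij_betwE[OF \<phi>] that by blast
  have "\<exists>y \<in> verts G - A. \<forall>a\<in>S. {a, y} \<in> edges G \<longleftrightarrow> rook (\<phi> a) z" for z
  proof -
    have "{a \<in> S. rook (\<phi> a) z} \<subseteq> S"
      by auto
    then obtain X where X: "X \<in> traces G A" "X \<inter> S = {a \<in> S. rook (\<phi> a) z}"
      using sh unfolding shatters_def by blast
    then obtain y where y: "y \<in> verts G - A" "X = {a \<in> A. {a, y} \<in> edges G}"
      unfolding traces_def by blast
    then have "{a, y} \<in> edges G \<longleftrightarrow> rook (\<phi> a) z" if "a \<in> S" for a
      using X(2) that S(1) by blast
    then show ?thesis
      using y(1) by blast
  qed
  then obtain b where b: "\<And>z. b z \<in> verts G - A" "\<And>z a. a \<in> S \<Longrightarrow> {a, b z} \<in> edges G \<longleftrightarrow> rook (\<phi> a) z"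
    by metis
  have rows: "q - 2 \<le> card {a \<in> S. rook (\<phi> a) z \<noteq> rook (\<phi> a) z'}" if "z \<in> ?g" "z' \<in> ?g" "z \<noteq> z'" for z z'
  proof -
    have "\<phi> ` {a \<in> S. rook (\<phi> a) z \<noteq> rook (\<phi> a) z'} = {p \<in> ?g. rook z p \<noteq> rook z' p}"
    proof -
      have "\<phi> ` {a \<in> S. Q (\<phi> a)} = {p \<in> ?g. Q p}" for Q
        unfolding bij_betw_imp_surj_on[OF \<phi>, symmetric] by blast
      then show ?thesis
        unfolding rook_sym[of _ z] rook_sym[of _ z'] .
    qed
    moreover have "inj_on \<phi> {a \<in> S. rook (\<phi> a) z \<noteq> rook (\<phi> a) z'}"
      by (rule inj_on_subset[OF bij_betw_imp_inj_on[OF \<phi>]]) auto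
    ultimately show ?thesis
      using rook_difference[OF that] card_image[of \<phi> "{a \<in> S. rook (\<phi> a) z \<noteq> rook (\<phi> a) z'}"]
      by simp
  qed
  have inj: "inj_on b ?g"
  proof (rule inj_onI, rule ccontr)
    fix z z' assume z: "z \<in> ?g" "z' \<in> ?g" "b z = b z'" "z \<noteq> z'"
    have "rook (\<phi> a) z = rook (\<phi> a) z'" if "a \<in> S" for a
      using b(2)[OF that, of z] b(2)[OF that, of z'] z(3) by simp
    then have none: "{a \<in> S. rook (\<phi> a) z \<noteq> rook (\<phi> a) z'} = {}"
      by blast
    show False
      using rows[OF z(1,2,4)] q unfolding none by simp
  qed
  define Y where "Y = b ` ?g"
  define W where "W = S \<union> Y"
  have SY: "S \<inter> Y = {}"
    using b(1) S(1) unfolding Y_def by auto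
  have WV: "W \<subseteq> verts G"
    using b(1) S(1) A unfolding W_def Y_def by auto
  have "card Y = q ^ 2"
    unfolding Y_def using card_image[OF inj] by (simp add: power2_eq_square)
  then have cW: "card W = 2 * q ^ 2"
    unfolding W_def using card_Un_disjoint[OF finS _ SY] S(2) unfolding Y_def by simp
  let ?H = "induced_subgraph G W"
  have H: "is_graph ?H" "verts ?H = S \<union> Y"
    using G finite_subset[OF WV finV]
    unfolding is_graph_def induced_subgraph_def all_pairs_def W_def by auto
  have eH: "{a, b z} \<in> edges ?H \<longleftrightarrow> rook (\<phi> a) z" if "a \<in> S" "z \<in> ?g" for a z
  proof -
    have "{a, b z} \<subseteq> W"
      using that unfolding W_def Y_def by blast
    then show ?thesis
      using b(2)[OF that(1), of z] unfolding induced_subgraph_def by simp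
  qed
  have "verts ?H \<noteq> {}"
    using cW q unfolding H(2) W_def[symmetric] by auto
  then obtain P R M where PRM: "resolution_sequence ?H P R M"
    "\<And>i. i \<le> M \<Longrightarrow> width_bound (verts ?H) 1 (merge_width 1 ?H) (P i) (R i)"
    using merge_width_attained[OF H(1)] by metis
  have "2 \<le> card S"
    using S(2) q power_mono[of 3 q 2] by simp
  then obtain x x' where x: "x \<in> S" "x' \<in> S" "x \<noteq> x'"
    using card_le_Suc0_iff_eq[OF finS] by fastforce
  have "q - 2 \<le> 2 * merge_width 1 ?H"
  proof (rule resolution_sequence.width_ge_half_difference[OF PRM(1) H(2) PRM(2) _ _ SY x])
    fix u u' assume u: "u \<in> S" "u' \<in> S" "u \<noteq> u'"
    have "({u, b z} \<in> edges ?H) \<noteq> ({u', b z} \<in> edges ?H) \<longleftrightarrow> rook (\<phi> u) z \<noteq> rook (\<phi> u') z"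
      if "z \<in> ?g" for z
      using eH[OF u(1) that] eH[OF u(2) that] by simp
    then have "{y \<in> Y. ({u, y} \<in> edges ?H) \<noteq> ({u', y} \<in> edges ?H)}
      = b ` {z \<in> ?g. rook (\<phi> u) z \<noteq> rook (\<phi> u') z}"
      unfolding Y_def by blast
    moreover have "inj_on b {z \<in> ?g. rook (\<phi> u) z \<noteq> rook (\<phi> u') z}"
      using inj by (rule inj_on_subset) auto
    moreover have "\<phi> u \<noteq> \<phi> u'"
      using \<phi> u unfolding bij_betw_def inj_on_def by blast
    ultimately show "q - 2 \<le> card {y \<in> Y. ({u, y} \<in> edges ?H) \<noteq> ({u', y} \<in> edges ?H)}"
      using rook_difference[OF \<phi>_in[OF u(1)] \<phi>_in[OF u(2)]] by (simp add: card_image)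
  next
    fix u u' assume u: "u \<in> Y" "u' \<in> Y" "u \<noteq> u'"
    then obtain z z' where z: "z \<in> ?g" "z' \<in> ?g" "u = b z" "u' = b z'" "z \<noteq> z'"
      unfolding Y_def by blast
    have "{x \<in> S. ({u, x} \<in> edges ?H) \<noteq> ({u', x} \<in> edges ?H)}
      = {a \<in> S. rook (\<phi> a) z \<noteq> rook (\<phi> a) z'}"
      using eH[OF _ z(1)] eH[OF _ z(2)] unfolding z(3,4) insert_commute[of "b _"] by blast
    then show "q - 2 \<le> card {x \<in> S. ({u, x} \<in> edges ?H) \<noteq> ({u', x} \<in> edges ?H)}"
      using rows[OF z(1,2,5)] by simp
  qed
  then show ?thesis
    using WV cW by blast
qed

section \<open>Almost bounded widths\<close>

text \<open>With \<open>q = s\<^sup>2\<close> the rook subgraph has \<open>2s\<^sup>4\<close> vertices, whose fourth root is at most \<open>2s\<close>.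
  Its radius-1 merge-width is then both at least \<open>(s\<^sup>2 - 2) / 2\<close> and at most \<open>2\<bar>c\<bar>s\<close>, which fails
  for \<open>s \<ge> 4\<bar>c\<bar> + 3\<close>.\<close>

lemma no_large_shattered_set:
  assumes "graph_class C" and "hereditary C" and "almost_bounded_merge_width C"
  obtains d where "d \<ge> 1"
    and "\<And>G A S. G \<in> C \<Longrightarrow> A \<subseteq> verts G \<Longrightarrow> S \<subseteq> A \<Longrightarrow> card S = d \<Longrightarrow> \<not> shatters (traces G A) S"
proof -
  have "\<exists>c::real. \<forall>G\<in>C. verts G \<noteq> {} \<longrightarrow> real (merge_width 1 G) \<le> c * real (card (verts G)) powr (1/4)"
    using assms(3) unfolding almost_bounded_merge_width_def almost_bounded_def by simp
  then obtain c :: real where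
    c: "\<And>G. G \<in> C \<Longrightarrow> verts G \<noteq> {} \<Longrightarrow> real (merge_width 1 G) \<le> c * real (card (verts G)) powr (1/4)"
    by blast
  define s where "s = nat \<lceil>4 * \<bar>c\<bar>\<rceil> + 3"
  have s: "real s \<ge> 4 * \<bar>c\<bar> + 3"
    unfolding s_def by linarith
  have s3: "s \<ge> 3"
    unfolding s_def by simp
  define q where "q = s ^ 2"
  have q3: "q \<ge> 3"
    using s3 power_mono[of 3 s 2] unfolding q_def by simp
  show ?thesis
  proof (rule that[of "q ^ 2"])
    show "q ^ 2 \<ge> 1"
      using q3 by simp
    fix G A S
    assume G: "G \<in> C" and A: "A \<subseteq> verts G" and S: "S \<subseteq> A" "card S = q ^ 2"
    show "\<not> shatters (traces G A) S"
    proof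
      assume sh: "shatters (traces G A) S"
      have "is_graph G"
        using assms(1) G unfolding graph_class_def by blast
      then obtain W where W: "W \<subseteq> verts G" "card W = 2 * q ^ 2"
        "q - 2 \<le> 2 * merge_width 1 (induced_subgraph G W)"
        using shattered_imp_rook_subgraph[OF _ A S sh q3] by blast
      let ?H = "induced_subgraph G W"
      have vH: "verts ?H = W"
        unfolding induced_subgraph_def by simp
      have H: "?H \<in> C" "verts ?H \<noteq> {}"
        using assms(2) G W q3 unfolding hereditary_def vH by auto
      have "real (card W) powr (1/4) \<le> (real (2 * s) ^ 4) powr (1/4)"
        by (rule powr_mono2) (simp_all add: W(2) q_def power_mult_distrib flip: power_mult)
      also have "\<dots> = real (2 * s)"
      proof -
        have "real (2 * s) ^ 4 = real (2 * s) powr 4"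
          using s3 by (subst powr_numeral) auto
        then show ?thesis
          using s3 by (simp only: powr_powr) simp
      qed
      finally have root: "real (card W) powr (1/4) \<le> 2 * real s"
        by simp
      have "real s ^ 2 - 2 = real (q - 2)"
        using q3 by (simp add: q_def of_nat_diff)
      also have "\<dots> \<le> 2 * real (merge_width 1 ?H)"
        using W(3) by (metis of_nat_le_iff of_nat_mult of_nat_numeral)
      also have "\<dots> \<le> 2 * (c * real (card W) powr (1/4))"
        using c[OF H] vH by simp
      also have "\<dots> \<le> 2 * (\<bar>c\<bar> * (2 * real s))"
        using root by (intro mult_left_mono mult_mono) auto
      finally have "real s ^ 2 \<le> 4 * \<bar>c\<bar> * real s + 2"
        by simp
      moreover have "(4 * \<bar>c\<bar> + 3) * real s \<le> real s ^ 2"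
        using s by (simp add: power2_eq_square mult_right_mono)
      ultimately show False
        using s3 by (simp add: algebra_simps)
    qed
  qed
qed

lemma flip_width_le:
  fixes G :: "'a graph" and r :: nat
  assumes G: "is_graph G" and ne: "verts G \<noteq> {}"
    and tr: "\<And>A S. A \<subseteq> verts G \<Longrightarrow> S \<subseteq> A \<Longrightarrow> card S = d \<Longrightarrow> \<not> shatters (traces G A) S"
  defines "k \<equiv> merge_width (2 * r + 1) G"
  shows "flip_width r G \<le> k + (k + 1) ^ d"
proof -
  obtain P R M where PRM: "resolution_sequence G P R M"
    "\<And>i. i \<le> M \<Longrightarrow> width_bound (verts G) (2 * r + 1) k (P i) (R i)"
    using merge_width_attained[OF G ne] unfolding k_def by metis
  have "card (traces G A) \<le> (k + 1) ^ d" if A: "A \<subseteq> verts G" "card A \<le> k" for A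
  proof -
    have "finite A"
      using A(1) G finite_subset unfolding is_graph_def by blast
    then have "card (traces G A) \<le> (card A + 1) ^ d"
      using tr[OF A(1)] by (intro sauer_shelah) (auto simp: traces_def)
    also have "\<dots> \<le> (k + 1) ^ d"
      using A(2) by (intro power_mono) auto
    finally show ?thesis .
  qed
  with PRM(2) have "flipper_wins r (k + (k + 1) ^ d) G"
    by (intro resolution_sequence.flipper_wins[OF PRM(1) ne])
  then show ?thesis
    unfolding flip_width_def by (rule Least_le)
qed

theorem theorem1p15:
  fixes C :: "'a graph set"
  assumes "graph_class C"
    and "hereditary C"
    and "almost_bounded_merge_width C"
  shows "almost_bounded_flip_width C"
  unfolding almost_bounded_flip_width_def almost_bounded_def
proof (intro allI impI)
  fix r :: nat and \<epsilon> :: real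
  assume \<epsilon>: "\<epsilon> > 0"
  obtain d where d: "d \<ge> 1"
    "\<And>G A S. G \<in> C \<Longrightarrow> A \<subseteq> verts G \<Longrightarrow> S \<subseteq> A \<Longrightarrow> card S = d \<Longrightarrow> \<not> shatters (traces G A) S"
    by (rule no_large_shattered_set[OF assms]) (rule that)
  \<comment> \<open>The bound on flip-width is of degree \<open>d\<close> in the merge-width.\<close>
  have "\<epsilon> / real d > 0"
    using \<epsilon> d(1) by simp
  then obtain c :: real where c: "\<And>G. G \<in> C \<Longrightarrow> verts G \<noteq> {} \<Longrightarrow>
    real (merge_width (2 * r + 1) G) \<le> c * real (card (verts G)) powr (\<epsilon> / real d)"
    using assms(3) unfolding almost_bounded_merge_width_def almost_bounded_def by metis
  show "\<exists>c::real. \<forall>G\<in>C. verts G \<noteq> {} \<longrightarrow> real (flip_width r G) \<le> c * real (card (verts G)) powr \<epsilon>"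
  proof (intro exI ballI impI)
    fix G assume G: "G \<in> C" "verts G \<noteq> {}"
    let ?k = "merge_width (2 * r + 1) G" and ?n = "real (card (verts G))"
    define x where "x = ?n powr (\<epsilon> / real d)"
    have gr: "is_graph G"
      using assms(1) G(1) unfolding graph_class_def by blast
    then have n: "?n \<ge> 1"
      using G(2) unfolding is_graph_def by (metis One_nat_def Suc_leI card_gt_0_iff of_nat_1 of_nat_mono)
    then have x: "x \<ge> 1"
      unfolding x_def using \<epsilon> by (intro ge_one_powr_ge_zero) auto
    have "real ?k + 1 \<le> c * x + x"
      using c[OF G] x unfolding x_def by simp
    also have "\<dots> \<le> (\<bar>c\<bar> + 1) * x"
      using x by (simp add: distrib_right mult_right_mono)
    finally have k: "real ?k + 1 \<le> (\<bar>c\<bar> + 1) * x" .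
    have "?k + 1 \<le> (?k + 1) ^ d"
      using d(1) by (intro self_le_power) auto
    moreover have "flip_width r G \<le> ?k + (?k + 1) ^ d"
      by (rule flip_width_le[OF gr G(2) d(2)[OF G(1)]])
    ultimately have "flip_width r G \<le> 2 * (?k + 1) ^ d"
      by linarith
    then have "real (flip_width r G) \<le> real (2 * (?k + 1) ^ d)"
      by (rule of_nat_mono)
    also have "\<dots> = 2 * (real ?k + 1) ^ d"
      by (simp add: add.commute)
    also have "\<dots> \<le> 2 * ((\<bar>c\<bar> + 1) * x) ^ d"
      using k by (intro mult_left_mono power_mono) auto
    also have "\<dots> = 2 * (\<bar>c\<bar> + 1) ^ d * x ^ d"
      by (simp add: power_mult_distrib)
    also have "x ^ d = ?n powr \<epsilon>"
      using n d(1) unfolding x_def by (simp add: powr_power)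
    finally show "real (flip_width r G) \<le> 2 * (\<bar>c\<bar> + 1) ^ d * ?n powr \<epsilon>" .
  qed
qed

end
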